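(* Let $A$ be a real $m\times n$ matrix with no zero rows and let $b\in\mathbb{R}^m$ be such that the linear system $Ax=b$ is consistent. Let $x_0\in\mathbb{R}^n$ be an arbitrarily chosen initial vector and define, for $k=0,1,2,\ldots$, $$x_{k+1}=x_k+2\,\frac{b_{i_k}-A_{i_k}^{T}x_k}{\|A_{i_k}\|^2}\,A_{i_k},\qquad i_k=(k \bmod m)+1 .$$ Then $\{x_0,x_1,x_2,\ldots\}$ lies on a sphere centered on the solution of $Ax=b$ that has the minimal distance to $x_0$.
   Context: $A_i^{T}$ denotes the $i$-th row of $A$ (so $A_i\in\mathbb{R}^n$ is a column vector), $b_i$ is the $i$-th entry of $b$, and $\|\cdot\|$ is the Euclidean norm; distances are Euclidean. *)

theory Defs
  imports "HOL-Analysis.Analysis"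
begin

end

theory Submission
  imports Defs
begin

text \<open>Each step reflects the iterate in the hyperplane of the \<open>i\<close>-th equation. Every
  solution lies on that hyperplane, so its distance to the iterates never changes; in particular
  this holds for the solution nearest to the starting point, which exists uniquely because the
  solution set is closed and convex.\<close>

lemma convex_matrix_solutions:
  fixes A :: "real ^ 'n ^ 'm"
  shows "convex {z. A *v z = b}"
  by (simp add: convex_def matrix_vector_right_distrib matrix_vector_mult_scaleR
      flip: scaleR_left_distrib)

lemma closed_matrix_solutions:
  fixes A :: "real ^ 'n ^ 'm"
  shows "closed {z. A *v z = b}"
  by (intro closed_Collect_eq continuous_intros matrix_vector_mult_linear_continuous_on)

text \<open>Closedness and nonemptiness make \<open>closest_point S p\<close> a minimiser; convexity
  makes it the only one.\<close>

lemma ex1_arg_min_dist: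
  fixes p :: "'a::euclidean_space"
  assumes "convex S" "closed S" "S \<noteq> {}"
  shows "\<exists>!c. is_arg_min (\<lambda>z. dist z p) (\<lambda>z. z \<in> S) c"
proof
  show "is_arg_min (\<lambda>z. dist z p) (\<lambda>z. z \<in> S) (closest_point S p)"
    using closest_point_exists[OF assms(2,3), of p]
    by (auto simp: is_arg_min_linorder dist_commute)
next
  fix c
  assume "is_arg_min (\<lambda>z. dist z p) (\<lambda>z. z \<in> S) c"
  then show "c = closest_point S p"
    by (intro closest_point_unique assms) (auto simp: is_arg_min_linorder dist_commute)
qed

text \<open>For nonzero \<open>a\<close>, the hyperplane through \<open>c\<close> with normal
  \<open>a\<close> is a mirror exchanging \<open>y\<close> and the new point, so \<open>c\<close> is
  equally far from both. For \<open>a = 0\<close> the displacement vanishes.\<close>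

lemma dist_hyperplane_reflection:
  fixes a c y :: "'a::real_inner"
  assumes "a \<bullet> c = \<beta>"
  shows "dist c (y + (2 * ((\<beta> - a \<bullet> y) / (norm a)\<^sup>2)) *\<^sub>R a) = dist c y"
proof (cases "a = 0")
  case False
  define t where "t = 2 * ((\<beta> - a \<bullet> y) / (norm a)\<^sup>2)"
  \<comment> \<open>Since \<open>c\<close> lies on the hyperplane, the residual in the numerator of
    \<open>t\<close> equals the inner product of \<open>a\<close> with \<open>c - y\<close>.\<close>
  have t: "t * (a \<bullet> a) = 2 * (a \<bullet> (c - y))"
    using False assms by (simp add: t_def power2_norm_eq_inner inner_diff_right)
  \<comment> \<open>The last factor of the correction term is zero by \<open>t\<close>.\<close>
  have "(norm ((c - y) - t *\<^sub>R a))\<^sup>2 = (norm (c - y))\<^sup>2 + t * (t * (a \<bullet> a) - 2 * (a \<bullet> (c - y)))"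
    by (simp add: power2_norm_eq_inner inner_diff_left inner_diff_right inner_commute algebra_simps)
  then have "norm ((c - y) - t *\<^sub>R a) = norm (c - y)"
    by (simp add: t)
  then show ?thesis
    by (simp add: dist_norm t_def algebra_simps)
qed simp

theorem theorem12:
  fixes A :: "real ^ 'n ^ 'm" and b :: "real ^ 'm"
    and idx :: "nat \<Rightarrow> 'm"
    and x0 :: "real ^ 'n" and x :: "nat \<Rightarrow> real ^ 'n"
  assumes numbering: "bij_betw idx {1..CARD('m)} UNIV"
    and nonzero_rows: "\<And>i. row i A \<noteq> 0"
    and consistent: "\<exists>z. A *v z = b"
    and init: "x 0 = x0"
    and step: "\<And>k. x (Suc k) =
      (let i = idx (k mod CARD('m) + 1)
       in x k + (2 * ((b $ i - row i A \<bullet> x k) / (norm (row i A))\<^sup>2)) *\<^sub>R row i A)"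
  shows "(\<exists>!c. is_arg_min (\<lambda>z. dist z x0) (\<lambda>z. A *v z = b) c) \<and>
    (\<forall>c. is_arg_min (\<lambda>z. dist z x0) (\<lambda>z. A *v z = b) c \<longrightarrow>
      (\<exists>r\<ge>0. range x \<subseteq> sphere c r))"
proof (intro conjI allI impI)
  show "\<exists>!c. is_arg_min (\<lambda>z. dist z x0) (\<lambda>z. A *v z = b) c"
    using ex1_arg_min_dist[OF convex_matrix_solutions closed_matrix_solutions, of A b x0] consistent
    by auto
next
  fix c
  assume "is_arg_min (\<lambda>z. dist z x0) (\<lambda>z. A *v z = b) c"
  then have "A *v c = b"
    by (simp add: is_arg_min_def)
  then have row: "row i A \<bullet> c = b $ i" for i
    by (auto simp: row_def matrix_vector_mul_component)
  \<comment> \<open>As \<open>c\<close> solves every equation, \<open>row\<close> supplies the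
    mirror condition for whichever row the step selects.\<close>
  have "dist c (x k) = dist c (x 0)" for k
    by (induction k) (simp_all only: step Let_def dist_hyperplane_reflection[OF row])
  then show "\<exists>r\<ge>0. range x \<subseteq> sphere c r"
    by (intro exI[of _ "dist c (x 0)"]) auto
qed

end
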